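(* Let $A$ be a commutative multiplicative hyperring with identity element $1$, let $u,v\in\mathbb{N}$ with $u>v$, and let $P_1,\ldots,P_n$ be $(u,v)$-absorbing primary hyperideals of $A$ each of which is a $\mathcal{C}$-hyperideal. If $rad(P_i)=rad(P_j)$ for all $i,j\in\{1,\ldots,n\}$, then $\bigcap_{i=1}^n P_i$ is a $(u,v)$-absorbing primary hyperideal of $A$.
   Context: $\mathbb{N}$ is the set of positive integers. A commutative multiplicative hyperring $(A,+,\circ)$ consists of an abelian group $(A,+)$ and a map $\circ$ from $A\times A$ to the nonempty subsets of $A$ which is associative ($\bigcup_{a\in y\circ z} x\circ a=\bigcup_{b\in x\circ y} b\circ z$), commutative ($x\circ y=y\circ x$), satisfies $(-x)\circ y=x\circ(-y)=-(x\circ y)$, and $(y+z)\circ x\subseteq y\circ x+z\circ x$, $x\circ(y+z)\subseteq x\circ y+x\circ z$. For subsets $B,C\subseteq A$, $B\circ C=\bigcup_{b\in B,c\in C} b\circ c$ and $B+C=\{b+c: b\in B, c\in C\}$; an iterated product $x_1\circ\cdots\circ x_n$ is a subset of $A$ (for $n=1$ it is $\{x_1\}$). An identity element $1$ satisfies $a\in 1\circ a$ for all $a\in A$. $x\in A$ is a unit if $1\in y\circ x$ for some $y\in A$; $U(A)$ is the set of units. A hyperideal is a nonempty subset $B\subseteq A$ with $x-y\in B$ for all $x,y\in B$ and $r\circ x\subseteq B$ for all $x\in B$, $r\in A$; it is proper if $B\ne A$. A proper hyperideal $B$ is prime if $x\circ y\subseteq B$ ($x,y\in A$) implies $x\in B$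 or $y\in B$. $rad(B)$ is the intersection of all prime hyperideals of $A$ containing $B$ (and $rad(B)=A$ if there are none). A hyperideal $B$ is a $\mathcal{C}$-hyperideal if for all $n\in\mathbb{N}$ and $a_1,\dots,a_n\in A$, $(a_1\circ\cdots\circ a_n)\cap B\neq\varnothing$ implies $a_1\circ\cdots\circ a_n\subseteq B$. For $u,v\in\mathbb{N}$ with $u>v$, a proper hyperideal $P$ is $(u,v)$-absorbing primary if whenever $x_1,\dots,x_u\in A\setminus U(A)$ and $x_1\circ\cdots\circ x_u\subseteq P$, then $x_1\circ\cdots\circ x_v\subseteq P$ or $x_{v+1}\circ\cdots\circ x_u\subseteq rad(P)$. *)

theory Defs
  imports Main "HOL-Library.Set_Algebras"
begin

text \<open>
  The additive group is a type of class \<open>ab_group_add\<close>; its universe is the whole hyperring.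
  On sets, \<open>+\<close> is the elementwise sum from Set_Algebras. The elementwise negative is
  written \<open>uminus ` B\<close>, because \<open>- B\<close> denotes the complement.
\<close>

locale comm_mult_hyperring =
  fixes mul :: "'a::ab_group_add \<Rightarrow> 'a \<Rightarrow> 'a set"
  assumes mul_nonempty: "mul x y \<noteq> {}"
    and mul_assoc: "(\<Union>a\<in>mul y z. mul x a) = (\<Union>b\<in>mul x y. mul b z)"
    and mul_commute: "mul x y = mul y x"
    and mul_minus_left: "mul (- x) y = uminus ` mul x y"
    and mul_minus_right: "mul x (- y) = uminus ` mul x y"
    and mul_add_left: "mul (y + z) x \<subseteq> mul y x + mul z x"
    and mul_add_right: "mul x (y + z) \<subseteq> mul x y + mul x z"

text \<open>
  An identity need not be unique, and the set of units refers to it, so it is a parameter.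
\<close>

locale comm_mult_hyperring_1 = comm_mult_hyperring mul
  for mul :: "'a::ab_group_add \<Rightarrow> 'a \<Rightarrow> 'a set" +
  fixes e :: 'a
  assumes mul_identity: "a \<in> mul e a"

definition set_mul :: "('a \<Rightarrow> 'a \<Rightarrow> 'a set) \<Rightarrow> 'a set \<Rightarrow> 'a set \<Rightarrow> 'a set" where
  "set_mul mul B C = (\<Union>b\<in>B. \<Union>c\<in>C. mul b c)"

text \<open>
  Iterated products are only meant for nonempty lists; the value on \<open>[]\<close> is a dummy.
\<close>

fun hprod :: "('a \<Rightarrow> 'a \<Rightarrow> 'a set) \<Rightarrow> 'a list \<Rightarrow> 'a set" where
  "hprod mul [] = {}"
| "hprod mul [x] = {x}"
| "hprod mul (x # y # ys) = set_mul mul {x} (hprod mul (y # ys))"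

definition hunits :: "('a \<Rightarrow> 'a \<Rightarrow> 'a set) \<Rightarrow> 'a \<Rightarrow> 'a set" where
  "hunits mul e = {x. \<exists>y. e \<in> mul y x}"

definition hyperideal :: "('a::ab_group_add \<Rightarrow> 'a \<Rightarrow> 'a set) \<Rightarrow> 'a set \<Rightarrow> bool" where
  "hyperideal mul B \<longleftrightarrow>
     B \<noteq> {} \<and> (\<forall>x\<in>B. \<forall>y\<in>B. x - y \<in> B) \<and> (\<forall>x\<in>B. \<forall>r. mul r x \<subseteq> B)"

definition proper_hyperideal :: "('a::ab_group_add \<Rightarrow> 'a \<Rightarrow> 'a set) \<Rightarrow> 'a set \<Rightarrow> bool" where
  "proper_hyperideal mul B \<longleftrightarrow> hyperideal mul B \<and> B \<noteq> UNIV"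

definition prime_hyperideal :: "('a::ab_group_add \<Rightarrow> 'a \<Rightarrow> 'a set) \<Rightarrow> 'a set \<Rightarrow> bool" where
  "prime_hyperideal mul B \<longleftrightarrow>
     proper_hyperideal mul B \<and> (\<forall>x y. mul x y \<subseteq> B \<longrightarrow> x \<in> B \<or> y \<in> B)"

text \<open>If no prime hyperideal contains \<open>B\<close>, this is \<open>\<Inter>{} = UNIV\<close>.\<close>

definition hrad :: "('a::ab_group_add \<Rightarrow> 'a \<Rightarrow> 'a set) \<Rightarrow> 'a set \<Rightarrow> 'a set" where
  "hrad mul B = \<Inter>{Q. prime_hyperideal mul Q \<and> B \<subseteq> Q}"

definition C_hyperideal :: "('a::ab_group_add \<Rightarrow> 'a \<Rightarrow> 'a set) \<Rightarrow> 'a set \<Rightarrow> bool" where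
  "C_hyperideal mul B \<longleftrightarrow>
     hyperideal mul B \<and>
     (\<forall>xs. xs \<noteq> [] \<longrightarrow> hprod mul xs \<inter> B \<noteq> {} \<longrightarrow> hprod mul xs \<subseteq> B)"

text \<open>Intended for \<open>0 < v < u\<close>, so that both \<open>take v xs\<close> and \<open>drop v xs\<close> are nonempty.\<close>

definition absorbing_primary ::
  "('a::ab_group_add \<Rightarrow> 'a \<Rightarrow> 'a set) \<Rightarrow> 'a \<Rightarrow> nat \<Rightarrow> nat \<Rightarrow> 'a set \<Rightarrow> bool" where
  "absorbing_primary mul e u v P \<longleftrightarrow>
     proper_hyperideal mul P \<and>
     (\<forall>xs. length xs = u \<longrightarrow> set xs \<subseteq> UNIV - hunits mul e \<longrightarrow> hprod mul xs \<subseteq> P \<longrightarrow>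
        hprod mul (take v xs) \<subseteq> P \<or> hprod mul (drop v xs) \<subseteq> hrad mul P)"

end

theory Submission
  imports Defs
begin

text \<open>
  A prime hyperideal containing a finite intersection of hyperideals contains one of them, so the
  radical commutes with finite intersections and the intersection has the common radical of the
  \<open>P i\<close>. If the first \<open>v\<close> factors of a product fail to land in some \<open>P i\<close>,
  the absorbing property of that single \<open>P i\<close> sends the remaining ones to this radical.
\<close>

lemma hyperideal_zero: "hyperideal mul B \<Longrightarrow> 0 \<in> B"
  unfolding hyperideal_def by (metis all_not_in_conv diff_self)

lemma hyperideal_INT:
  assumes "\<And>i. i \<in> I \<Longrightarrow> hyperideal mul (P i)"
  shows "hyperideal mul (\<Inter>i\<in>I. P i)"
  unfolding hyperideal_def
proof (intro conjI ballI allI)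
  \<comment> \<open>Zero serves as a common element: every hyperideal contains it as a difference
    \<open>x - x\<close>, so the intersection is nonempty.\<close>
  have "0 \<in> (\<Inter>i\<in>I. P i)"
    using assms by (auto intro: hyperideal_zero)
  then show "(\<Inter>i\<in>I. P i) \<noteq> {}"
    by (metis empty_iff)
next
  fix x y assume x: "x \<in> (\<Inter>i\<in>I. P i)" and y: "y \<in> (\<Inter>i\<in>I. P i)"
  show "x - y \<in> (\<Inter>i\<in>I. P i)"
  proof (rule INT_I)
    fix i assume i: "i \<in> I"
    then show "x - y \<in> P i"
      using assms[OF i] INT_D[OF x i] INT_D[OF y i] unfolding hyperideal_def by simp
  qed
next
  fix x r assume x: "x \<in> (\<Inter>i\<in>I. P i)"
  show "mul r x \<subseteq> (\<Inter>i\<in>I. P i)"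
  proof (rule INT_greatest)
    fix i assume i: "i \<in> I"
    then show "mul r x \<subseteq> P i"
      using assms[OF i] INT_D[OF x i] unfolding hyperideal_def by simp
  qed
qed

context comm_mult_hyperring
begin

text \<open>For \<open>b\<close> in \<open>B\<close> and \<open>c\<close> in \<open>C\<close>, both
  outside \<open>Q\<close>, absorption puts \<open>mul b c\<close> into \<open>C\<close> and
  \<open>mul c b\<close> into \<open>B\<close>. By commutativity these are one set, which therefore
  lies in \<open>Q\<close>, against primeness.\<close>

lemma prime_hyperideal_Int_subset:
  assumes "prime_hyperideal mul Q" "hyperideal mul B" "hyperideal mul C" "B \<inter> C \<subseteq> Q"
  shows "B \<subseteq> Q \<or> C \<subseteq> Q"
proof (rule ccontr)
  assume "\<not> ?thesis"
  then obtain b c where bc: "b \<in> B" "b \<notin> Q" "c \<in> C" "c \<notin> Q"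
    by blast
  have "mul b c \<subseteq> C" "mul c b \<subseteq> B"
    using assms(2,3) bc unfolding hyperideal_def by blast+
  then have "mul b c \<subseteq> Q"
    using assms(4) mul_commute[of b c] by blast
  then show False
    using assms(1) bc unfolding prime_hyperideal_def by blast
qed

text \<open>Induction on \<open>I\<close> splits off one hyperideal at a time; the binary case
  applies because the intersection of the others is again a hyperideal.\<close>

lemma prime_hyperideal_INT_subset:
  assumes "finite I" "prime_hyperideal mul Q" "(\<Inter>i\<in>I. P i) \<subseteq> Q"
    and "\<And>i. i \<in> I \<Longrightarrow> hyperideal mul (P i)"
  shows "\<exists>i\<in>I. P i \<subseteq> Q"
  using assms(1,3,4)
proof (induction I rule: finite_induct)
  \<comment> \<open>The empty intersection is \<open>UNIV\<close>, which the proper hyperideal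
    \<open>Q\<close> cannot contain, so the premise is contradictory.\<close>
  case empty
  then show ?case
    using assms(2) unfolding prime_hyperideal_def proper_hyperideal_def by auto
next
  case (insert i I)
  have "P i \<inter> (\<Inter>i\<in>I. P i) \<subseteq> Q"
    using insert.prems(1) by simp
  moreover have "hyperideal mul (\<Inter>i\<in>I. P i)"
    using insert.prems(2) by (intro hyperideal_INT) simp
  ultimately have "P i \<subseteq> Q \<or> (\<Inter>i\<in>I. P i) \<subseteq> Q"
    using assms(2) insert.prems(2) by (intro prime_hyperideal_Int_subset) simp_all
  then show ?case
    using insert.IH insert.prems(2) by auto
qed

lemma hrad_INT:
  assumes "finite I" "\<And>i. i \<in> I \<Longrightarrow> hyperideal mul (P i)"
  shows "hrad mul (\<Inter>i\<in>I. P i) = (\<Inter>i\<in>I. hrad mul (P i))"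
proof
  show "hrad mul (\<Inter>i\<in>I. P i) \<subseteq> (\<Inter>i\<in>I. hrad mul (P i))"
    unfolding hrad_def by blast
  show "(\<Inter>i\<in>I. hrad mul (P i)) \<subseteq> hrad mul (\<Inter>i\<in>I. P i)"
  proof
    fix x assume x: "x \<in> (\<Inter>i\<in>I. hrad mul (P i))"
    \<comment> \<open>Finiteness of \<open>I\<close> enters here: \<open>Q\<close> already contains
      a single \<open>P i\<close>, so it is one of the primes whose intersection is
      \<open>hrad mul (P i)\<close>, and \<open>x\<close> lies in that.\<close>
    have "x \<in> Q" if Q: "prime_hyperideal mul Q" "(\<Inter>i\<in>I. P i) \<subseteq> Q" for Q
    proof -
      obtain i where "i \<in> I" "P i \<subseteq> Q"
        using prime_hyperideal_INT_subset[OF assms(1) Q] assms(2) by blast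
      then show ?thesis
        using x Q(1) unfolding hrad_def by blast
    qed
    then show "x \<in> hrad mul (\<Inter>i\<in>I. P i)"
      unfolding hrad_def by blast
  qed
qed

end

theorem proposition2p15:
  fixes mul :: "'a::ab_group_add \<Rightarrow> 'a \<Rightarrow> 'a set"
    and e :: 'a
    and u v n :: nat
    and P :: "nat \<Rightarrow> 'a set"
  assumes "comm_mult_hyperring_1 mul e"
    and "v \<ge> 1" and "u > v" and "n \<ge> 1"
    and "\<And>i. i \<in> {1..n} \<Longrightarrow> absorbing_primary mul e u v (P i)"
    and "\<And>i. i \<in> {1..n} \<Longrightarrow> C_hyperideal mul (P i)"
    and "\<And>i j. i \<in> {1..n} \<Longrightarrow> j \<in> {1..n} \<Longrightarrow> hrad mul (P i) = hrad mul (P j)"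
  shows "absorbing_primary mul e u v (\<Inter>i\<in>{1..n}. P i)"
proof -
  interpret comm_mult_hyperring_1 mul e by (fact assms(1))
  have proper: "proper_hyperideal mul (P i)" if "i \<in> {1..n}" for i
    using assms(5)[OF that] unfolding absorbing_primary_def by blast
  then have ideal: "hyperideal mul (P i)" if "i \<in> {1..n}" for i
    using that unfolding proper_hyperideal_def by blast
  \<comment> \<open>Since \<open>n \<ge> 1\<close>, the intersection lies inside the proper
    hyperideal \<open>P 1\<close> and is therefore proper itself.\<close>
  have one: "1 \<in> {1..n}"
    using assms(4) by simp
  have "hyperideal mul (\<Inter>i\<in>{1..n}. P i)"
    by (rule hyperideal_INT) (rule ideal)
  moreover have "(\<Inter>i\<in>{1..n}. P i) \<noteq> UNIV"
    using one proper[OF one] unfolding proper_hyperideal_def by blast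
  ultimately have proper_INT: "proper_hyperideal mul (\<Inter>i\<in>{1..n}. P i)"
    unfolding proper_hyperideal_def by (rule conjI)
  have rad: "hrad mul (\<Inter>i\<in>{1..n}. P i) = hrad mul (P i)" if "i \<in> {1..n}" for i
  proof -
    have "hrad mul (\<Inter>j\<in>{1..n}. P j) = (\<Inter>j\<in>{1..n}. hrad mul (P j))"
      by (rule hrad_INT) (simp_all add: ideal)
    also have "\<dots> = (\<Inter>j\<in>{1..n}. hrad mul (P i))"
      by (rule INF_cong[OF refl]) (rule assms(7)[OF _ that])
    \<comment> \<open>A constant intersection collapses to its value only over a nonempty index set;
      \<open>i\<close> itself is the witness.\<close>
    also have "\<dots> = hrad mul (P i)"
      using that by (subst INT_constant) auto
    finally show ?thesis .
  qed
  have "hprod mul (take v xs) \<subseteq> (\<Inter>i\<in>{1..n}. P i) \<or>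
      hprod mul (drop v xs) \<subseteq> hrad mul (\<Inter>i\<in>{1..n}. P i)"
    if xs: "length xs = u" "set xs \<subseteq> UNIV - hunits mul e"
      "hprod mul xs \<subseteq> (\<Inter>i\<in>{1..n}. P i)" for xs
  proof (rule disjCI)
    \<comment> \<open>By \<open>rad\<close>, this one assumption denies the second alternative for
      every \<open>P i\<close> at once, so the absorbing property of each \<open>P i\<close> must
      yield its first alternative.\<close>
    assume not_rad: "\<not> hprod mul (drop v xs) \<subseteq> hrad mul (\<Inter>i\<in>{1..n}. P i)"
    show "hprod mul (take v xs) \<subseteq> (\<Inter>i\<in>{1..n}. P i)"
    proof (rule INT_greatest)
      fix i assume i: "i \<in> {1..n}"
      have "hprod mul xs \<subseteq> P i"
        using xs(3) INT_lower[OF i, of P] by (rule order_trans)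
      then have "hprod mul (take v xs) \<subseteq> P i \<or> hprod mul (drop v xs) \<subseteq> hrad mul (P i)"
        using assms(5)[OF i] xs(1,2) unfolding absorbing_primary_def by simp
      then show "hprod mul (take v xs) \<subseteq> P i"
        using not_rad unfolding rad[OF i] by simp
    qed
  qed
  then show ?thesis
    using proper_INT unfolding absorbing_primary_def by simp
qed

end
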